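(* Let $\alpha_t\equiv\alpha$, $\beta_t\equiv\beta$ be constant with $0<\kappa<1$, where $\kappa:=1-\alpha/\beta$. Consider $n$ consecutive optimally selected switches at times $0=\theta_0<\theta_1<\dots<\theta_n<1=\theta_{n+1}$. If $\pi=0$ on $[0,\theta_1)$ (so that $\gamma_{\theta_1}=1$ and $\pi=1$ after $\theta_1$), then there cannot be a further switching from sparing to candid mode: the existence of a second switch $\theta_2$ would entail, with $\bar\kappa_1=\kappa\gamma_{\theta_1}=\kappa=e^{-\lambda g(\theta_1)}$, $$\theta_3=\theta_2+\frac{1-\bar\kappa_1e^{\lambda g(\theta_1)}}{\bar\kappa_1e^{\lambda g(\theta_1)}\lambda h(\theta_2)}=\theta_2,$$ contradicting $\theta_2<\theta_3$. Hence $n\le1$.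
   Context: Fix $\sigma>0$ and $\lambda>0$. Let $\Phi$ be the standard normal distribution function, and for $t\in[0,1]$ put $h(t)=2\Phi(\sigma(1-t)/2)-1$ and $g(t)=\int_0^t h(u)\,\mathrm{d}u$. Constants $0<\alpha<\beta$ are given. A policy with $n$ consecutive switches at $0=\theta_0<\theta_1<\dots<\theta_n<1=\theta_{n+1}$ is a function $\pi$ that is constant, equal to $0$ (candid) or $1$ (sparing), on each interval $[\theta_{j},\theta_{j+1})$, with alternating values on consecutive intervals. The state (valuation) $\gamma_t$ solves $\gamma_t'=-\lambda\pi_t h(t)\gamma_t$, $\gamma_0=1$; write $\gamma^1_t=e^{-\lambda g(t)}$. The objective to be maximized is $\int_0^1(1-\pi_t)\,\beta\,[\gamma^1_t-\kappa\gamma_t]\,\mathrm{d}t$. The switches are selected optimally when, for each $1\le i\le n$, the location $\theta=\theta_i$ maximizes over $\theta\in(\theta_{i-1},\theta_{i+1})$, with the other locations and the initial mode held fixed, its impact on the objective as measured by $$\int_{\theta_{i-1}}^{\theta}(1-\pi_t)[\gamma^1_t-\kappa\gamma_t]\,\mathrm{d}t+\int_{\theta}^{\theta_{i+1}}(1-\pi_t)[\gamma^1_t-\kappa\gamma_t]\,\mathrm{d}t,$$ where $\pi$ and $\gamma$ are those of the policy with the $i$-th switch located at $\theta$. *)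

theory Defs
  imports "HOL-Probability.Probability"
begin

definition Phi :: "real \<Rightarrow> real" where
  "Phi = cdf std_normal_distribution"

definition h_fun :: "real \<Rightarrow> real \<Rightarrow> real" where
  "h_fun \<sigma> t = 2 * Phi (\<sigma> * (1 - t) / 2) - 1"

definition g_fun :: "real \<Rightarrow> real \<Rightarrow> real" where
  "g_fun \<sigma> t = integral {0..t} (h_fun \<sigma>)"

definition gamma1 :: "real \<Rightarrow> real \<Rightarrow> real \<Rightarrow> real" where
  "gamma1 \<sigma> lam t = exp (- lam * g_fun \<sigma> t)"

(* Only the indices 0, ..., n + 1 of \<theta> are meaningful. *)
definition switch_times :: "nat \<Rightarrow> (nat \<Rightarrow> real) \<Rightarrow> bool" where
  "switch_times n \<theta> \<longleftrightarrow> \<theta> 0 = 0 \<and> \<theta> (Suc n) = 1 \<and> (\<forall>j\<le>n. \<theta> j < \<theta> (Suc j))"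

(* Mode 0 is candid, mode 1 is sparing.  The values of \<pi> outside [0, 1) are irrelevant. *)
definition policy :: "nat \<Rightarrow> (nat \<Rightarrow> real) \<Rightarrow> (real \<Rightarrow> real) \<Rightarrow> bool" where
  "policy n \<theta> \<pi> \<longleftrightarrow>
     switch_times n \<theta> \<and>
     (\<forall>j\<le>n. \<pi> (\<theta> j) \<in> {0, 1} \<and> (\<forall>t\<in>{\<theta> j..<\<theta> (Suc j)}. \<pi> t = \<pi> (\<theta> j))) \<and>
     (\<forall>j<n. \<pi> (\<theta> (Suc j)) \<noteq> \<pi> (\<theta> j))"

(* Since \<pi> jumps at the switches, the differential equation is required between consecutive
   switches; continuity on [0, 1] glues the pieces, so \<gamma> is determined on [0, 1] by \<pi>. *)
definition valuation ::
  "real \<Rightarrow> real \<Rightarrow> nat \<Rightarrow> (nat \<Rightarrow> real) \<Rightarrow> (real \<Rightarrow> real) \<Rightarrow> (real \<Rightarrow> real) \<Rightarrow> bool" where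
  "valuation \<sigma> lam n \<theta> \<pi> \<gamma> \<longleftrightarrow>
     continuous_on {0..1} \<gamma> \<and> \<gamma> 0 = 1 \<and>
     (\<forall>t\<in>{0<..<1} - \<theta> ` {1..n}.
        (\<gamma> has_real_derivative - lam * \<pi> t * h_fun \<sigma> t * \<gamma> t) (at t))"

(* Contribution to the objective of the window [a, b] around a switch located at x. *)
definition impact ::
  "real \<Rightarrow> real \<Rightarrow> real \<Rightarrow> (real \<Rightarrow> real) \<Rightarrow> (real \<Rightarrow> real) \<Rightarrow> real \<Rightarrow> real \<Rightarrow> real \<Rightarrow> real" where
  "impact \<sigma> lam \<kappa> \<pi> \<gamma> a x b =
     integral {a..x} (\<lambda>t. (1 - \<pi> t) * (gamma1 \<sigma> lam t - \<kappa> * \<gamma> t)) +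
     integral {x..b} (\<lambda>t. (1 - \<pi> t) * (gamma1 \<sigma> lam t - \<kappa> * \<gamma> t))"

(* \<pi>' and \<gamma>' are the policy and valuation obtained by moving the i-th switch to x; they are
   determined on [0, 1) by x, the other switches and the initial mode. *)
definition optimally_selected ::
  "real \<Rightarrow> real \<Rightarrow> real \<Rightarrow> nat \<Rightarrow> (nat \<Rightarrow> real) \<Rightarrow> (real \<Rightarrow> real) \<Rightarrow> (real \<Rightarrow> real) \<Rightarrow> bool" where
  "optimally_selected \<sigma> lam \<kappa> n \<theta> \<pi> \<gamma> \<longleftrightarrow>
     (\<forall>i\<in>{1..n}. \<forall>x\<in>{\<theta> (i - 1)<..<\<theta> (i + 1)}. \<forall>\<pi>' \<gamma>'.
        policy n (\<theta>(i := x)) \<pi>' \<and> \<pi>' 0 = \<pi> 0 \<and>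
        valuation \<sigma> lam n (\<theta>(i := x)) \<pi>' \<gamma>' \<longrightarrow>
        impact \<sigma> lam \<kappa> \<pi>' \<gamma>' (\<theta> (i - 1)) x (\<theta> (i + 1))
          \<le> impact \<sigma> lam \<kappa> \<pi> \<gamma> (\<theta> (i - 1)) (\<theta> i) (\<theta> (i + 1)))"

end

(* While the first switch moves, the valuation on the initial candid phase stays equal to 1, so its
   first-order condition is kappa = gamma1 (theta 1).  Consequently, if the second switch is located
   at x, the candid integrand after it is gamma1 t - gamma1 x, which vanishes at t = x.  Delaying the
   switch therefore costs nothing to first order, but it strictly lowers the valuation on the whole
   remaining window: the impact has a positive derivative in x, so no location is optimal. *)

theory Submission
  imports Defs
begin

section \<open>The standard normal distribution function\<close>

lemma std_normal_measure_singleton: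
  "measure std_normal_distribution {x} = 0"
proof -
  have "{x} \<in> null_sets std_normal_distribution"
    using eventually_mono[OF AE_lborel_singleton[of x]]
    by (subst null_sets_density_iff) force+
  then show ?thesis
    by (simp add: null_setsD1 measure_def)
qed

text \<open>Reflection at the origin preserves Lebesgue measure and the even density, so the two
  closed half-lines have equal mass. They cover the line and share only the null set
  \<open>{0}\<close>.\<close>

lemma std_normal_measure_atMost_0:
  "measure std_normal_distribution {..0} = 1 / 2"
proof -
  let ?N = std_normal_distribution
  interpret real_distribution ?N by (rule real_dist_normal_dist)
  have "emeasure ?N {..0} = (\<integral>\<^sup>+x. ennreal (std_normal_density x) * indicator {..0} x \<partial>lborel)"
    by (simp add: emeasure_density)
  also have "\<dots> = (\<integral>\<^sup>+x. ennreal (std_normal_density x) * indicator {..0} x \<partial>distr lborel borel uminus)"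
    by (simp add: lborel_distr_uminus)
  also have "\<dots> = (\<integral>\<^sup>+x. ennreal (std_normal_density (- x)) * indicator {..0} (- x) \<partial>lborel)"
    by (subst nn_integral_distr) auto
  also have "\<dots> = (\<integral>\<^sup>+x. ennreal (std_normal_density x) * indicator {0..} x \<partial>lborel)"
    by (intro nn_integral_cong) (auto simp: std_normal_density_def indicator_def)
  also have "\<dots> = emeasure ?N {0..}"
    by (simp add: emeasure_density)
  finally have sym: "measure ?N {..0} = measure ?N {0..}"
    by (simp add: measure_def)
  have "measure ?N {..0} + measure ?N {0<..} = 1"
    by (subst finite_measure_Union[symmetric]) (auto intro!: prob_eq_1[THEN iffD2] AE_I2)
  moreover have "measure ?N {0..} = measure ?N {0} + measure ?N {0<..}"
    by (subst finite_measure_Union[symmetric]) (auto intro!: arg_cong[where f = "measure ?N"])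
  ultimately show ?thesis
    using sym std_normal_measure_singleton[of 0] by simp
qed

text \<open>The density is positive everywhere, so \<open>{0<..y}\<close>, having positive length,
  cannot be null; its mass comes on top of the half carried by \<open>{..0}\<close>.\<close>

lemma Phi_gt_half:
  assumes "0 < y"
  shows "1 / 2 < Phi y"
proof -
  let ?N = std_normal_distribution
  interpret real_distribution ?N by (rule real_dist_normal_dist)
  have "measure ?N {0<..y} \<noteq> 0"
  proof
    assume "measure ?N {0<..y} = 0"
    then have "{0<..y} \<in> null_sets ?N"
      by (auto simp: null_sets_def emeasure_eq_measure)
    then have "AE x in lborel. x \<notin> {0<..y}"
      using normal_density_pos[of 1 0]
      by (subst (asm) null_sets_density_iff) (auto elim!: eventually_mono simp: less_le)
    then have "emeasure lborel {0<..y} = 0"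
      by (subst (asm) AE_iff_measurable[of "{0<..y}"]) auto
    then show False using assms by simp
  qed
  then have "0 < measure ?N {0<..y}"
    by (simp add: less_le)
  moreover have "Phi y = measure ?N {..0} + measure ?N {0<..y}"
    unfolding Phi_def cdf_def using assms
    by (subst finite_measure_Union[symmetric]) (auto intro!: arg_cong[where f = "measure ?N"])
  ultimately show ?thesis
    using std_normal_measure_atMost_0 by simp
qed

lemma isCont_Phi: "isCont Phi x"
proof -
  interpret real_distribution std_normal_distribution by (rule real_dist_normal_dist)
  show ?thesis
    unfolding Phi_def isCont_cdf by (rule std_normal_measure_singleton)
qed

section \<open>Regularity of \<open>h_fun\<close>, \<open>g_fun\<close> and
  \<open>gamma1\<close>\<close>

lemma continuous_on_h_fun: "continuous_on S (h_fun \<sigma>)"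
proof -
  have "continuous_on UNIV Phi"
    by (simp add: continuous_at_imp_continuous_on isCont_Phi)
  then have "continuous_on S (\<lambda>t. Phi (\<sigma> * (1 - t) / 2))"
    by (rule continuous_on_compose2) (auto intro!: continuous_intros)
  then show ?thesis
    unfolding h_fun_def by (intro continuous_intros)
qed

text \<open>For \<open>t < 1\<close> the argument of \<open>Phi\<close> is positive, while at
  \<open>t = 1\<close> the value drops to 0. The strict sign at the second switch produces the final
  contradiction.\<close>

lemma h_fun_pos:
  assumes "0 < \<sigma>" "t < 1"
  shows "0 < h_fun \<sigma> t"
  using Phi_gt_half[of "\<sigma> * (1 - t) / 2"] assms by (simp add: h_fun_def)

text \<open>At an interior point the derivative within the interval is a two-sided one, which is the
  form that the test for local maxima requires.\<close>

lemma integral_has_derivative_at: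
  fixes f :: "real \<Rightarrow> real"
  assumes "continuous_on {a..b} f" "a < t" "t < b"
  shows "((\<lambda>x. integral {a..x} f) has_real_derivative f t) (at t)"
  using integral_has_real_derivative[OF assms(1), of t] assms at_within_Icc_at[of a t b]
  by simp

lemma g_fun_has_derivative:
  assumes "0 < t"
  shows "(g_fun \<sigma> has_real_derivative h_fun \<sigma> t) (at t)"
  \<comment> \<open>As \<open>h_fun\<close> is continuous everywhere, any right endpoint beyond
    \<open>t\<close> serves. To the left of 0 the interval of integration is empty and
    \<open>g_fun\<close> is 0, hence the restriction to \<open>0 < t\<close>.\<close>
  using integral_has_derivative_at[OF continuous_on_h_fun, of 0 t "t + 1"] assms
  by (simp add: g_fun_def[abs_def])

lemma continuous_on_g_fun: "continuous_on {0..b} (g_fun \<sigma>)"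
  unfolding g_fun_def[abs_def]
  by (intro indefinite_integral_continuous_1 integrable_continuous_real continuous_on_h_fun)

lemma gamma1_has_derivative:
  assumes "0 < t"
  shows "(gamma1 \<sigma> lam has_real_derivative - lam * h_fun \<sigma> t * gamma1 \<sigma> lam t) (at t)"
  unfolding gamma1_def[abs_def]
  by (auto intro!: derivative_eq_intros g_fun_has_derivative assms)

lemma continuous_on_gamma1: "continuous_on {0..b} (gamma1 \<sigma> lam)"
  unfolding gamma1_def[abs_def] by (intro continuous_intros continuous_on_g_fun)

section \<open>Ordering of the switch times\<close>

lemma switch_times_strict_mono:
  assumes "switch_times n \<theta>" "i < j" "j \<le> Suc n"
  shows "\<theta> i < \<theta> j"
  using assms(2,3)
proof (induction j)
  case (Suc j)
  have "\<theta> j < \<theta> (Suc j)"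
    using assms(1) Suc.prems by (auto simp: switch_times_def)
  with Suc show ?case
    by (cases "i = j") (auto intro: less_trans)
qed simp

lemma switch_times_mono:
  assumes "switch_times n \<theta>" "i \<le> j" "j \<le> Suc n"
  shows "\<theta> i \<le> \<theta> j"
  using switch_times_strict_mono[OF assms(1), of i j] assms by (cases "i = j") auto

lemma switch_times_bounds:
  assumes "switch_times n \<theta>" "j \<le> Suc n"
  shows "0 \<le> \<theta> j" "\<theta> j \<le> 1"
  using switch_times_mono[OF assms(1), of 0 j] switch_times_mono[OF assms(1), of j "Suc n"] assms
  by (auto simp: switch_times_def)

text \<open>The differential equation in \<open>valuation\<close> is postulated only off the
  switches; this makes it available throughout the interior of each piece.\<close>

lemma switch_times_no_switch_between:
  assumes "switch_times n \<theta>" "j \<le> n" "\<theta> j < t" "t < \<theta> (Suc j)"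
  shows "t \<notin> \<theta> ` {1..n}"
proof
  assume "t \<in> \<theta> ` {1..n}"
  then obtain k where "k \<le> n" "t = \<theta> k" by auto
  then show False
    using assms switch_times_mono[OF assms(1), of k j] switch_times_mono[OF assms(1), of "Suc j" k]
    by (cases "k \<le> j") auto
qed

lemma switch_times_piece:
  assumes "switch_times n \<theta>" "0 \<le> t" "t < 1"
  obtains j where "j \<le> n" "\<theta> j \<le> t" "t < \<theta> (Suc j)"
proof -
  \<comment> \<open>Minimality supplies the left bound: the predecessor of \<open>?j\<close> fails
    the test, which says \<open>\<theta> ?j \<le> t\<close>. For \<open>?j = 0\<close> the bound is
    \<open>0 \<le> t\<close>.\<close>
  let ?j = "LEAST j. t < \<theta> (Suc j)"
  have n: "t < \<theta> (Suc n)"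
    using assms by (simp add: switch_times_def)
  have "t < \<theta> (Suc ?j)" by (rule LeastI) (rule n)
  moreover have "?j \<le> n" by (rule Least_le) (rule n)
  moreover have "\<theta> ?j \<le> t"
  proof (cases ?j)
    case 0
    then show ?thesis using assms by (simp add: switch_times_def)
  next
    case (Suc k)
    then show ?thesis using not_less_Least[of k "\<lambda>j. t < \<theta> (Suc j)"] by simp
  qed
  ultimately show ?thesis using that by blast
qed

lemma switch_times_fun_upd:
  assumes "switch_times n \<theta>" "i \<in> {1..n}" "\<theta> (i - 1) < x" "x < \<theta> (i + 1)"
  shows "switch_times n (\<theta>(i := x))"
  using assms unfolding switch_times_def by auto

text \<open>On the \<open>j\<close>-th interval exactly the switches \<open>1, \<dots>, j\<close> have occurred, so counting the
  switches up to time \<open>t\<close> recovers \<open>j\<close>.\<close>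

lemma policy_transfer:
  assumes pol: "policy n \<theta> \<pi>" and st: "switch_times n \<theta>'"
  obtains \<pi>' where "policy n \<theta>' \<pi>'" "\<pi>' 0 = \<pi> 0"
proof -
  define \<pi>' where "\<pi>' t = \<pi> (\<theta> (card {k \<in> {1..n}. \<theta>' k \<le> t}))" for t
  have val: "\<pi>' t = \<pi> (\<theta> j)" if "j \<le> n" "\<theta>' j \<le> t" "t < \<theta>' (Suc j)" for j t
  proof -
    have "{k \<in> {1..n}. \<theta>' k \<le> t} = {1..j}"
    proof (intro set_eqI iffI)
      fix k assume k: "k \<in> {k \<in> {1..n}. \<theta>' k \<le> t}"
      have "k \<le> j"
        using k that switch_times_mono[OF st, of "Suc j" k] by (cases "k \<le> j") auto
      with k show "k \<in> {1..j}" by simp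
    next
      fix k assume "k \<in> {1..j}"
      then show "k \<in> {k \<in> {1..n}. \<theta>' k \<le> t}"
        using that switch_times_mono[OF st, of k j] by auto
    qed
    then show ?thesis by (simp add: \<pi>'_def)
  qed
  have at_switch: "\<pi>' (\<theta>' j) = \<pi> (\<theta> j)" if "j \<le> n" for j
    using val[of j "\<theta>' j"] that st by (auto simp: switch_times_def)
  have "policy n \<theta>' \<pi>'"
    using pol st val at_switch unfolding policy_def by auto
  moreover have "\<pi>' 0 = \<pi> 0"
    using at_switch[of 0] st pol by (simp add: switch_times_def policy_def)
  ultimately show ?thesis using that by blast
qed

section \<open>Existence and explicit form of the valuation\<close>

lemma policy_const_on_piece:
  assumes "policy n \<theta> \<pi>" "j \<le> n" "\<theta> j \<le> t" "t < \<theta> (Suc j)"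
  shows "\<pi> t = \<pi> (\<theta> j)"
  using assms unfolding policy_def by (meson atLeastLessThan_iff)

text \<open>Induction over the switches: on each closed piece the integrand agrees with a continuous
  function except possibly at the right endpoint, where the next mode already holds.\<close>

lemma policy_h_fun_integrable:
  assumes pol: "policy n \<theta> \<pi>"
  shows "(\<lambda>t. \<pi> t * h_fun \<sigma> t) integrable_on {0..1}"
proof -
  have st: "switch_times n \<theta>" using pol by (simp add: policy_def)
  have "(\<lambda>t. \<pi> t * h_fun \<sigma> t) integrable_on {0..\<theta> k}" if "k \<le> Suc n" for k
    using that
  proof (induction k)
    case 0
    then show ?case
      using st integrable_on_refl[of "\<lambda>t. \<pi> t * h_fun \<sigma> t" 0] by (simp add: switch_times_def)
  next
    case (Suc k)
    have "(\<lambda>t. \<pi> t * h_fun \<sigma> t) integrable_on {\<theta> k..\<theta> (Suc k)}"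
    proof (rule integrable_spike_finite)
      show "finite {\<theta> (Suc k)}" by simp
      show "\<pi> t * h_fun \<sigma> t = \<pi> (\<theta> k) * h_fun \<sigma> t" if "t \<in> {\<theta> k..\<theta> (Suc k)} - {\<theta> (Suc k)}" for t
        using that Suc.prems policy_const_on_piece[OF pol, of k t] by auto
      show "(\<lambda>t. \<pi> (\<theta> k) * h_fun \<sigma> t) integrable_on {\<theta> k..\<theta> (Suc k)}"
        by (intro integrable_continuous_real continuous_intros continuous_on_h_fun)
    qed
    then show ?case
      using Suc switch_times_bounds(1)[OF st, of k] switch_times_mono[OF st, of k "Suc k"]
      by (intro Henstock_Kurzweil_Integration.integrable_combine[of 0 "\<theta> k" "\<theta> (Suc k)"]) auto
  qed
  from this[of "Suc n"] show ?thesis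
    using st by (simp add: switch_times_def)
qed

text \<open>The explicit solution is the exponential of \<open>- lam\<close> times the integral of
  \<open>\<pi> t * h_fun \<sigma> t\<close>. Without a valuation for the moved policy, the
  comparison in \<open>optimally_selected\<close> would be vacuous at that location.\<close>

lemma valuation_exists:
  assumes pol: "policy n \<theta> \<pi>"
  obtains \<gamma> where "valuation \<sigma> lam n \<theta> \<pi> \<gamma>"
proof -
  have st: "switch_times n \<theta>" using pol by (simp add: policy_def)
  let ?f = "\<lambda>t. \<pi> t * h_fun \<sigma> t"
  let ?I = "\<lambda>t. integral {0..t} ?f"
  have int: "?f integrable_on {0..1}" by (rule policy_h_fun_integrable[OF pol])
  have deriv: "(?I has_real_derivative ?f t) (at t)"
    if t: "t \<in> {0<..<1} - \<theta> ` {1..n}" for t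
  proof -
    obtain j where j: "j \<le> n" "\<theta> j \<le> t" "t < \<theta> (Suc j)"
      using switch_times_piece[OF st, of t] t by auto
    \<comment> \<open>Equality is impossible: \<open>t\<close> is not a switch, which settles
      \<open>j \<ge> 1\<close>, and \<open>0 < t\<close> settles \<open>j = 0\<close>. Hence
      \<open>\<pi>\<close> is constant in a whole neighbourhood of \<open>t\<close>.\<close>
    have "\<theta> j < t"
      using j t st by (cases j) (auto simp: switch_times_def less_le)
    have *: "eventually (\<lambda>s. s \<in> {\<theta> j<..<\<theta> (Suc j)}) (nhds t)"
      using \<open>\<theta> j < t\<close> j by (intro eventually_nhds_in_open) auto
    have "isCont (\<lambda>s. \<pi> (\<theta> j) * h_fun \<sigma> s) t"
      using continuous_on_h_fun[of UNIV \<sigma>] by (auto simp: continuous_on_eq_continuous_at)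
    moreover have "eventually (\<lambda>s. \<pi> (\<theta> j) * h_fun \<sigma> s = ?f s) (nhds t)"
      using *
      by eventually_elim (metis policy_const_on_piece[OF pol j(1)] greaterThanLessThan_iff less_imp_le)
    ultimately have "isCont ?f t"
      by (rule iffD1[OF isCont_cong, rotated])
    then have "continuous (at t within {0..1} - {}) ?f"
      by (simp add: continuous_at_imp_continuous_at_within)
    then have "(?I has_vector_derivative ?f t) (at t within {0..1} - {})"
      using t by (intro integral_has_vector_derivative_continuous_at int) auto
    then show ?thesis
      using t at_within_Icc_at[of 0 t 1] by (simp add: has_real_derivative_iff_has_vector_derivative)
  qed
  have "valuation \<sigma> lam n \<theta> \<pi> (\<lambda>t. exp (- lam * ?I t))"
    unfolding valuation_def
  proof (intro conjI ballI)
    show "continuous_on {0..1} (\<lambda>t. exp (- lam * ?I t))"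
      by (intro continuous_intros indefinite_integral_continuous_1 int)
    show "((\<lambda>t. exp (- lam * ?I t)) has_real_derivative
        - lam * \<pi> t * h_fun \<sigma> t * exp (- lam * ?I t)) (at t)"
      if "t \<in> {0<..<1} - \<theta> ` {1..n}" for t
      by (auto intro!: derivative_eq_intros deriv[OF that])
  qed simp
  then show ?thesis using that by blast
qed

text \<open>Integrating factor: \<open>\<gamma> s * exp (lam * \<pi> (\<theta> j) * g_fun \<sigma>
  s)\<close> has derivative 0 inside the piece, and continuity extends its constancy to both
  endpoints.\<close>

lemma valuation_on_piece:
  assumes pol: "policy n \<theta> \<pi>" and val: "valuation \<sigma> lam n \<theta> \<pi> \<gamma>"
    and j: "j \<le> n" "\<theta> j \<le> t" "t \<le> \<theta> (Suc j)"
  shows "\<gamma> t = \<gamma> (\<theta> j) * exp (- lam * \<pi> (\<theta> j) * (g_fun \<sigma> t - g_fun \<sigma> (\<theta> j)))"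
proof (cases "t = \<theta> j")
  case False
  have st: "switch_times n \<theta>" using pol by (simp add: policy_def)
  have bounds: "0 \<le> \<theta> j" "t \<le> 1" "\<theta> j < t"
    using switch_times_bounds[OF st, of j] switch_times_bounds[OF st, of "Suc j"] j False by auto
  let ?c = "lam * \<pi> (\<theta> j)"
  let ?u = "\<lambda>s. \<gamma> s * exp (?c * g_fun \<sigma> s)"
  have "?u t = ?u (\<theta> j)"
  proof (rule DERIV_isconst_end[OF \<open>\<theta> j < t\<close>])
    have "continuous_on {\<theta> j..t} \<gamma>"
      using val bounds by (auto simp: valuation_def elim!: continuous_on_subset)
    moreover have "continuous_on {\<theta> j..t} (g_fun \<sigma>)"
      using continuous_on_g_fun[of 1 \<sigma>] bounds by (auto elim!: continuous_on_subset)
    ultimately show "continuous_on {\<theta> j..t} ?u"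
      by (intro continuous_intros)
    fix s assume s: "\<theta> j < s" "s < t"
    have "s \<notin> \<theta> ` {1..n}"
      using switch_times_no_switch_between[OF st j(1), of s] s j by auto
    then have "(\<gamma> has_real_derivative - lam * \<pi> s * h_fun \<sigma> s * \<gamma> s) (at s)"
      using val s bounds by (auto simp: valuation_def)
    moreover have "\<pi> s = \<pi> (\<theta> j)"
      using s j by (intro policy_const_on_piece[OF pol]) auto
    ultimately have "(\<gamma> has_real_derivative - ?c * h_fun \<sigma> s * \<gamma> s) (at s)"
      by simp
    moreover have "(g_fun \<sigma> has_real_derivative h_fun \<sigma> s) (at s)"
      using s bounds by (intro g_fun_has_derivative) auto
    ultimately show "(?u has_real_derivative 0) (at s)"
      by (auto intro!: derivative_eq_intros simp: algebra_simps)
  qed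
  then have "\<gamma> t = \<gamma> (\<theta> j) * exp (?c * g_fun \<sigma> (\<theta> j)) * exp (- (?c * g_fun \<sigma> t))"
    by (simp add: exp_minus field_simps)
  also have "\<dots> = \<gamma> (\<theta> j) * exp (- lam * \<pi> (\<theta> j) * (g_fun \<sigma> t - g_fun \<sigma> (\<theta> j)))"
    by (simp add: mult.assoc exp_add[symmetric] algebra_simps)
  finally show ?thesis .
qed simp

section \<open>Closed formulas for a policy that starts candid\<close>

lemma policy_mode:
  assumes pol: "policy n \<theta> \<pi>" and "\<pi> 0 = 0" and "j \<le> n"
  shows "\<pi> (\<theta> j) = (if even j then 0 else 1)"
  using assms(3)
proof (induction j)
  case 0
  then show ?case using assms by (simp add: policy_def switch_times_def)
next
  case (Suc j)
  have "\<pi> (\<theta> (Suc j)) \<noteq> \<pi> (\<theta> j)" "\<pi> (\<theta> (Suc j)) \<in> {0, 1}"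
    using pol Suc.prems by (auto simp: policy_def)
  with Suc show ?case by (auto split: if_splits)
qed

lemma policy_on_piece:
  assumes "policy n \<theta> \<pi>" "\<pi> 0 = 0" "j \<le> n" "\<theta> j \<le> t" "t < \<theta> (Suc j)"
  shows "\<pi> t = (if even j then 0 else 1)"
  using policy_const_on_piece[OF assms(1,3-5)] policy_mode[OF assms(1-3)] by simp

text \<open>On a candid piece the factor \<open>1 - \<pi> t\<close> is 1, except possibly at the
  right endpoint, which belongs to the next piece or to the horizon; a single point is null.\<close>

lemma integral_policy_even_piece:
  assumes "policy n \<theta> \<pi>" "\<pi> 0 = 0" "j \<le> n" "even j"
  shows "integral {\<theta> j..\<theta> (Suc j)} (\<lambda>t. (1 - \<pi> t) * f t) = integral {\<theta> j..\<theta> (Suc j)} f"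
  by (rule integral_spike[of "{\<theta> (Suc j)}"]) (use policy_on_piece[OF assms(1-3)] assms(4) in auto)

lemma integral_policy_odd_piece:
  fixes f :: "real \<Rightarrow> real"
  assumes "policy n \<theta> \<pi>" "\<pi> 0 = 0" "j \<le> n" "odd j"
  shows "integral {\<theta> j..\<theta> (Suc j)} (\<lambda>t. (1 - \<pi> t) * f t) = 0"
proof -
  have "integral {\<theta> j..\<theta> (Suc j)} (\<lambda>t. (1 - \<pi> t) * f t) = integral {\<theta> j..\<theta> (Suc j)} (\<lambda>_. 0)"
    by (rule integral_spike[of "{\<theta> (Suc j)}"]) (use policy_on_piece[OF assms(1-3)] assms(4) in auto)
  then show ?thesis by simp
qed

lemma valuation_initial_candid:
  assumes "policy n \<theta> \<pi>" "valuation \<sigma> lam n \<theta> \<pi> \<gamma>" "\<pi> 0 = 0" "0 \<le> t" "t \<le> \<theta> 1"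
  shows "\<gamma> t = 1"
  using valuation_on_piece[OF assms(1,2), of 0 t] assms
  by (simp add: policy_def switch_times_def valuation_def)

text \<open>Only the sparing phase between the first two switches has lowered the valuation, by the
  factor \<open>exp (- lam * (g_fun \<sigma> (\<theta> 2) - g_fun \<sigma> (\<theta> 1)))\<close>.
  The form chosen separates the dependence on \<open>\<theta> 1\<close> from that on
  \<open>\<theta> 2\<close>.\<close>

lemma valuation_second_candid:
  assumes pol: "policy n \<theta> \<pi>" and val: "valuation \<sigma> lam n \<theta> \<pi> \<gamma>" and "\<pi> 0 = 0" "2 \<le> n"
    and "\<theta> 2 \<le> t" "t \<le> \<theta> 3"
  shows "\<gamma> t = exp (lam * g_fun \<sigma> (\<theta> 1)) * gamma1 \<sigma> lam (\<theta> 2)"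
proof -
  have st: "switch_times n \<theta>" using pol by (simp add: policy_def)
  have "\<gamma> (\<theta> 1) = 1"
    using valuation_initial_candid[OF pol val] switch_times_bounds[OF st, of 1] assms by auto
  moreover have "\<gamma> (\<theta> 2) = \<gamma> (\<theta> 1) * exp (- lam * (g_fun \<sigma> (\<theta> 2) - g_fun \<sigma> (\<theta> 1)))"
    using valuation_on_piece[OF pol val, of 1 "\<theta> 2"] policy_mode[OF pol, of 1] assms
      switch_times_mono[OF st, of 1 2] by (simp add: numeral_2_eq_2)
  moreover have "\<gamma> t = \<gamma> (\<theta> 2)"
    using valuation_on_piece[OF pol val, of 2 t] policy_mode[OF pol, of 2] assms
    by (simp add: numeral_3_eq_3 numeral_2_eq_2)
  ultimately show ?thesis
    by (simp add: gamma1_def exp_add[symmetric] algebra_simps)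
qed

text \<open>The sparing half of the window contributes nothing, and on the candid half the valuation
  is still 1. For \<open>n = 1\<close> the right end \<open>\<theta> 2\<close> is the horizon
  1.\<close>

lemma impact_first_switch:
  assumes pol: "policy n \<theta> \<pi>" and val: "valuation \<sigma> lam n \<theta> \<pi> \<gamma>" and "\<pi> 0 = 0" "1 \<le> n"
  shows "impact \<sigma> lam \<kappa> \<pi> \<gamma> (\<theta> 0) (\<theta> 1) (\<theta> 2) = integral {0..\<theta> 1} (\<lambda>t. gamma1 \<sigma> lam t - \<kappa>)"
proof -
  have "\<theta> 0 = 0" using pol by (simp add: policy_def switch_times_def)
  moreover have "integral {0..\<theta> 1} (\<lambda>t. gamma1 \<sigma> lam t - \<kappa> * \<gamma> t) =
      integral {0..\<theta> 1} (\<lambda>t. gamma1 \<sigma> lam t - \<kappa>)"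
    using valuation_initial_candid[OF pol val \<open>\<pi> 0 = 0\<close>] by (intro integral_cong) auto
  ultimately show ?thesis
    using integral_policy_even_piece[OF pol \<open>\<pi> 0 = 0\<close>, of 0 "\<lambda>t. gamma1 \<sigma> lam t - \<kappa> * \<gamma> t"]
      integral_policy_odd_piece[OF pol \<open>\<pi> 0 = 0\<close>, of 1 "\<lambda>t. gamma1 \<sigma> lam t - \<kappa> * \<gamma> t"] assms
    by (simp add: impact_def numeral_2_eq_2)
qed

text \<open>Now the candid half comes second, and the valuation is constant there. With
  \<open>\<theta> 1\<close> and \<open>\<theta> 3\<close> fixed this is an explicit function of
  \<open>\<theta> 2\<close>, ready to be differentiated.\<close>

lemma impact_second_switch:
  assumes pol: "policy n \<theta> \<pi>" and val: "valuation \<sigma> lam n \<theta> \<pi> \<gamma>" and "\<pi> 0 = 0" "2 \<le> n"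
  shows "impact \<sigma> lam \<kappa> \<pi> \<gamma> (\<theta> 1) (\<theta> 2) (\<theta> 3) =
    integral {\<theta> 2..\<theta> 3} (gamma1 \<sigma> lam) -
    (\<theta> 3 - \<theta> 2) * (\<kappa> * exp (lam * g_fun \<sigma> (\<theta> 1)) * gamma1 \<sigma> lam (\<theta> 2))"
proof -
  have st: "switch_times n \<theta>" using pol by (simp add: policy_def)
  have bounds: "0 \<le> \<theta> 2" "\<theta> 2 \<le> \<theta> 3"
    using switch_times_bounds[OF st, of 2] switch_times_mono[OF st, of 2 3] assms by auto
  let ?c = "\<kappa> * exp (lam * g_fun \<sigma> (\<theta> 1)) * gamma1 \<sigma> lam (\<theta> 2)"
  have "integral {\<theta> 2..\<theta> 3} (\<lambda>t. gamma1 \<sigma> lam t - \<kappa> * \<gamma> t) =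
      integral {\<theta> 2..\<theta> 3} (\<lambda>t. gamma1 \<sigma> lam t - ?c)"
    using valuation_second_candid[OF pol val assms(3,4)] by (intro integral_cong) auto
  also have "\<dots> = integral {\<theta> 2..\<theta> 3} (gamma1 \<sigma> lam) - integral {\<theta> 2..\<theta> 3} (\<lambda>t. ?c)"
    using bounds continuous_on_subset[OF continuous_on_gamma1[of "\<theta> 3" \<sigma> lam], of "{\<theta> 2..\<theta> 3}"]
    by (intro Henstock_Kurzweil_Integration.integral_diff integrable_continuous_real) auto
  finally have "integral {\<theta> 2..\<theta> 3} (\<lambda>t. gamma1 \<sigma> lam t - \<kappa> * \<gamma> t) =
      integral {\<theta> 2..\<theta> 3} (gamma1 \<sigma> lam) - (\<theta> 3 - \<theta> 2) * ?c"
    using bounds by simp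
  then show ?thesis
    using integral_policy_odd_piece[OF pol \<open>\<pi> 0 = 0\<close>, of 1 "\<lambda>t. gamma1 \<sigma> lam t - \<kappa> * \<gamma> t"]
      integral_policy_even_piece[OF pol \<open>\<pi> 0 = 0\<close>, of 2 "\<lambda>t. gamma1 \<sigma> lam t - \<kappa> * \<gamma> t"] assms
    by (simp add: impact_def numeral_2_eq_2 numeral_3_eq_3)
qed

section \<open>First-order conditions at the first two switches\<close>

text \<open>Optimality is a statement about all policies and valuations realizing the moved switch.
  Supplying one such pair turns it into a usable inequality at each admissible location.\<close>

lemma optimally_selected_shift:
  assumes pol: "policy n \<theta> \<pi>" and opt: "optimally_selected \<sigma> lam \<kappa> n \<theta> \<pi> \<gamma>"
    and i: "i \<in> {1..n}" "\<theta> (i - 1) < x" "x < \<theta> (i + 1)"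
  obtains \<pi>' \<gamma>' where "policy n (\<theta>(i := x)) \<pi>'" "\<pi>' 0 = \<pi> 0"
    "valuation \<sigma> lam n (\<theta>(i := x)) \<pi>' \<gamma>'"
    "impact \<sigma> lam \<kappa> \<pi>' \<gamma>' (\<theta> (i - 1)) x (\<theta> (i + 1))
      \<le> impact \<sigma> lam \<kappa> \<pi> \<gamma> (\<theta> (i - 1)) (\<theta> i) (\<theta> (i + 1))"
proof -
  have "switch_times n (\<theta>(i := x))"
    using pol i by (intro switch_times_fun_upd) (auto simp: policy_def)
  then obtain \<pi>' where \<pi>': "policy n (\<theta>(i := x)) \<pi>'" "\<pi>' 0 = \<pi> 0"
    using policy_transfer[OF pol] by blast
  obtain \<gamma>' where \<gamma>': "valuation \<sigma> lam n (\<theta>(i := x)) \<pi>' \<gamma>'"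
    using valuation_exists[OF \<pi>'(1)] by blast
  have "impact \<sigma> lam \<kappa> \<pi>' \<gamma>' (\<theta> (i - 1)) x (\<theta> (i + 1))
      \<le> impact \<sigma> lam \<kappa> \<pi> \<gamma> (\<theta> (i - 1)) (\<theta> i) (\<theta> (i + 1))"
    using opt[unfolded optimally_selected_def, rule_format, of i x \<pi>' \<gamma>'] i \<pi>' \<gamma>' by simp
  with \<pi>' \<gamma>' show ?thesis by (rule that)
qed

text \<open>As a function of its location \<open>x\<close>, the impact of the first switch has
  derivative \<open>gamma1 \<sigma> lam x - \<kappa>\<close>, which must vanish at an interior
  maximum.\<close>

lemma optimal_first_switch:
  assumes pol: "policy n \<theta> \<pi>" and val: "valuation \<sigma> lam n \<theta> \<pi> \<gamma>"
    and opt: "optimally_selected \<sigma> lam \<kappa> n \<theta> \<pi> \<gamma>" and "\<pi> 0 = 0" "1 \<le> n"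
  shows "\<kappa> = gamma1 \<sigma> lam (\<theta> 1)"
proof -
  have st: "switch_times n \<theta>" using pol by (simp add: policy_def)
  have bounds: "\<theta> 0 = 0" "0 < \<theta> 1" "\<theta> 1 < \<theta> 2"
    using st switch_times_strict_mono[OF st, of 0 1] switch_times_strict_mono[OF st, of 1 2] assms
    by (auto simp: switch_times_def)
  let ?G = "\<lambda>x. integral {0..x} (\<lambda>t. gamma1 \<sigma> lam t - \<kappa>)"
  have le: "?G x \<le> ?G (\<theta> 1)" if "0 < x" "x < \<theta> 2" for x
  proof -
    have idx: "(1::nat) - 1 = 0" "(1::nat) + 1 = 2" by simp_all
    have i: "1 \<in> {1..n}" "\<theta> 0 < x" "x < \<theta> 2" using that bounds assms by auto
    obtain \<pi>' \<gamma>' where *: "policy n (\<theta>(1 := x)) \<pi>'" "\<pi>' 0 = \<pi> 0"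
        "valuation \<sigma> lam n (\<theta>(1 := x)) \<pi>' \<gamma>'"
        "impact \<sigma> lam \<kappa> \<pi>' \<gamma>' (\<theta> 0) x (\<theta> 2) \<le> impact \<sigma> lam \<kappa> \<pi> \<gamma> (\<theta> 0) (\<theta> 1) (\<theta> 2)"
      using optimally_selected_shift[OF pol opt, of 1 x, unfolded idx, OF i] by blast
    then show ?thesis
      using impact_first_switch[OF *(1,3)] impact_first_switch[OF pol val] assms by simp
  qed
  have "(?G has_real_derivative gamma1 \<sigma> lam (\<theta> 1) - \<kappa>) (at (\<theta> 1))"
    using bounds
    by (intro integral_has_derivative_at[where b = "\<theta> 2"] continuous_intros continuous_on_gamma1) auto
  \<comment> \<open>This radius keeps every competitor strictly between 0 and
    \<open>\<theta> 2\<close>, inside the window of admissible locations.\<close>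
  moreover have "0 < min (\<theta> 1) (\<theta> 2 - \<theta> 1)" using bounds by simp
  moreover have "\<forall>y. \<bar>\<theta> 1 - y\<bar> < min (\<theta> 1) (\<theta> 2 - \<theta> 1) \<longrightarrow> ?G y \<le> ?G (\<theta> 1)"
    using le by auto
  ultimately have "gamma1 \<sigma> lam (\<theta> 1) - \<kappa> = 0"
    by (rule DERIV_local_max)
  then show ?thesis by simp
qed

lemma no_optimal_second_switch:
  assumes "0 < \<sigma>" "0 < lam"
    and pol: "policy n \<theta> \<pi>" and val: "valuation \<sigma> lam n \<theta> \<pi> \<gamma>"
    and opt: "optimally_selected \<sigma> lam \<kappa> n \<theta> \<pi> \<gamma>" and "\<pi> 0 = 0"
  shows "n \<le> 1"
proof (rule ccontr)
  assume "\<not> n \<le> 1"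
  then have n: "2 \<le> n" by simp
  have st: "switch_times n \<theta>" using pol by (simp add: policy_def)
  \<comment> \<open>With \<open>2 \<le> n\<close> the index 3 is at most \<open>Suc n\<close>, so
    \<open>\<theta> 3\<close> is the next switch or the horizon. This forces
    \<open>\<theta> 2 < 1\<close>, where \<open>h_fun\<close> is positive.\<close>
  have bounds: "0 < \<theta> 1" "\<theta> 1 < \<theta> 2" "\<theta> 2 < \<theta> 3" "\<theta> 3 \<le> 1"
    using st switch_times_strict_mono[OF st, of 0 1] switch_times_strict_mono[OF st, of 1 2]
      switch_times_strict_mono[OF st, of 2 3] switch_times_bounds(2)[OF st, of 3] n
    by (auto simp: switch_times_def)
  \<comment> \<open>The condition at the first switch cancels the constant in the impact of the
    second one. It remains usable while the second switch moves, because \<open>\<theta> 1\<close>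
    stays fixed.\<close>
  have \<kappa>: "\<kappa> * exp (lam * g_fun \<sigma> (\<theta> 1)) = 1"
    using optimal_first_switch[OF pol val opt] assms n by (simp add: gamma1_def exp_minus)
  \<comment> \<open>This is the formula for the impact of the second switch located at
    \<open>x\<close>, with the cancelled factor replaced by 1.\<close>
  let ?F = "\<lambda>x. integral {x..\<theta> 3} (gamma1 \<sigma> lam) - (\<theta> 3 - x) * gamma1 \<sigma> lam x"
  have le: "?F x \<le> ?F (\<theta> 2)" if "\<theta> 1 < x" "x < \<theta> 3" for x
  proof -
    have idx: "(2::nat) - 1 = 1" "(2::nat) + 1 = 3" by simp_all
    have i: "2 \<in> {1..n}" "\<theta> 1 < x" "x < \<theta> 3" using n that by simp_all
    obtain \<pi>' \<gamma>' where *: "policy n (\<theta>(2 := x)) \<pi>'" "\<pi>' 0 = \<pi> 0"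
        "valuation \<sigma> lam n (\<theta>(2 := x)) \<pi>' \<gamma>'"
        "impact \<sigma> lam \<kappa> \<pi>' \<gamma>' (\<theta> 1) x (\<theta> 3) \<le> impact \<sigma> lam \<kappa> \<pi> \<gamma> (\<theta> 1) (\<theta> 2) (\<theta> 3)"
      using optimally_selected_shift[OF pol opt, of 2 x, unfolded idx, OF i] by blast
    then show ?thesis
      using impact_second_switch[OF *(1,3), of \<kappa>] impact_second_switch[OF pol val, of \<kappa>] assms n \<kappa>
      by simp
  qed
  have "((\<lambda>x. integral {x..\<theta> 3} (gamma1 \<sigma> lam)) has_real_derivative - gamma1 \<sigma> lam (\<theta> 2))
      (at (\<theta> 2))"
    using integral_has_real_derivative'[OF continuous_on_gamma1, of "\<theta> 2" "\<theta> 3" \<sigma> lam] bounds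
      at_within_Icc_at[of 0 "\<theta> 2" "\<theta> 3"] by simp
  \<comment> \<open>The lower limit of the integral contributes
    \<open>- gamma1 \<sigma> lam (\<theta> 2)\<close>, and the shrinking length
    \<open>\<theta> 3 - x\<close> contributes the same with the opposite sign. What survives is
    \<open>\<theta> 3 - \<theta> 2\<close> times minus the derivative of
    \<open>gamma1\<close>.\<close>
  then have "(?F has_real_derivative (\<theta> 3 - \<theta> 2) * (lam * h_fun \<sigma> (\<theta> 2) * gamma1 \<sigma> lam (\<theta> 2)))
      (at (\<theta> 2))"
    using gamma1_has_derivative[of "\<theta> 2" \<sigma> lam] bounds
    by (auto intro!: derivative_eq_intros simp: algebra_simps)
  moreover have "0 < min (\<theta> 2 - \<theta> 1) (\<theta> 3 - \<theta> 2)" using bounds by simp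
  moreover have "\<forall>y. \<bar>\<theta> 2 - y\<bar> < min (\<theta> 2 - \<theta> 1) (\<theta> 3 - \<theta> 2) \<longrightarrow> ?F y \<le> ?F (\<theta> 2)"
    using le by auto
  ultimately have "(\<theta> 3 - \<theta> 2) * (lam * h_fun \<sigma> (\<theta> 2) * gamma1 \<sigma> lam (\<theta> 2)) = 0"
    by (rule DERIV_local_max)
  moreover have "0 < gamma1 \<sigma> lam (\<theta> 2)" by (simp add: gamma1_def)
  ultimately show False
    using h_fun_pos[of \<sigma> "\<theta> 2"] assms bounds by simp
qed

theorem mainTheorem7:
  fixes \<sigma> lam \<alpha> \<beta> \<kappa> :: real
    and n :: nat
    and \<theta> :: "nat \<Rightarrow> real"
    and \<pi> \<gamma> :: "real \<Rightarrow> real"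
  assumes "\<sigma> > 0" and "lam > 0"
    and "0 < \<alpha>" and "\<alpha> < \<beta>"
    and "\<kappa> = 1 - \<alpha> / \<beta>" and "0 < \<kappa>" and "\<kappa> < 1"
    and "policy n \<theta> \<pi>"
    and "valuation \<sigma> lam n \<theta> \<pi> \<gamma>"
    and "optimally_selected \<sigma> lam \<kappa> n \<theta> \<pi> \<gamma>"
    and "\<forall>t\<in>{0..<\<theta> 1}. \<pi> t = 0"
  shows "\<gamma> (\<theta> 1) = 1 \<and>
    (1 \<le> n \<longrightarrow>
       (\<forall>t\<in>{\<theta> 1..<\<theta> 2}. \<pi> t = 1) \<and>
       \<kappa> * \<gamma> (\<theta> 1) = \<kappa> \<and> \<kappa> = exp (- lam * g_fun \<sigma> (\<theta> 1))) \<and>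
    (2 \<le> n \<longrightarrow>
       (let \<kappa>\<^sub>1 = \<kappa> * \<gamma> (\<theta> 1); E = exp (lam * g_fun \<sigma> (\<theta> 1)) in
          \<theta> 3 = \<theta> 2 + (1 - \<kappa>\<^sub>1 * E) / (\<kappa>\<^sub>1 * E * lam * h_fun \<sigma> (\<theta> 2)) \<and>
          \<theta> 2 + (1 - \<kappa>\<^sub>1 * E) / (\<kappa>\<^sub>1 * E * lam * h_fun \<sigma> (\<theta> 2)) = \<theta> 2)) \<and>
    n \<le> 1"
proof -
  note pol = \<open>policy n \<theta> \<pi>\<close> and val = \<open>valuation \<sigma> lam n \<theta> \<pi> \<gamma>\<close>
    and opt = \<open>optimally_selected \<sigma> lam \<kappa> n \<theta> \<pi> \<gamma>\<close>
  have st: "switch_times n \<theta>" using pol by (simp add: policy_def)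
  have pos: "0 < \<theta> 1"
    using st switch_times_strict_mono[OF st, of 0 1] by (simp add: switch_times_def)
  have init: "\<pi> 0 = 0"
    using assms(11) pos by simp
  have le1: "n \<le> 1"
    using no_optimal_second_switch[OF assms(1,2) pol val opt init] .
  \<comment> \<open>This covers \<open>n = 0\<close> too, where \<open>\<theta> 1\<close> is the
    horizon 1 and the closed initial piece is all of \<open>{0..1}\<close>.\<close>
  have \<gamma>1: "\<gamma> (\<theta> 1) = 1"
    using valuation_initial_candid[OF pol val init] pos by simp
  have "\<kappa> = exp (- lam * g_fun \<sigma> (\<theta> 1))" if "1 \<le> n"
    using optimal_first_switch[OF pol val opt init that] by (simp add: gamma1_def)
  moreover have "\<forall>t\<in>{\<theta> 1..<\<theta> 2}. \<pi> t = 1" if "1 \<le> n"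
    using policy_on_piece[OF pol init that] by (simp add: numeral_2_eq_2)
  \<comment> \<open>The clause under \<open>2 \<le> n\<close> is closed by \<open>n \<le> 1\<close>,
    which contradicts its premise.\<close>
  ultimately show ?thesis
    using le1 \<gamma>1 by auto
qed

end
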